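(* For $\alpha>0$ and $q\ge2$, let $\mathcal{C}\subseteq\mathbb{R}^d$ be a compact $(\alpha,q)$-uniformly convex set of diameter $\delta>0$, let $f\colon\mathcal{C}\to\mathbb{R}$ be a convex and $L$-smooth function satisfying a $(\mu,\theta)$-Hölderian error bound for some $\mu>0$ and $\theta\in[0,1/2]$ with unique minimizer $x^*\in\operatorname{argmin}_{x\in\mathcal{C}}f(x)$. Let $T\in\mathbb{N}$ and $\eta_t=\frac{4}{t+4}$ for all $t\in\mathbb{Z}$. Then, for the iterates $x_t$ of the Frank-Wolfe algorithm with step-size $\eta_t$, with $h_t=f(x_t)-f(x^* )$, it holds that $$h_t\le\max\left\{\eta_{t-2}^{1/(1-2\theta/q)}\frac{L\delta^2}{2},\ \left(\eta_{t-2}L\left(\frac{2\mu}{\alpha}\right)^{2/q}\right)^{1/(1-2\theta/q)}+\eta_{t-2}^2\frac{L\delta^2}{2}\right\}$$ for all $t\in\{1,\ldots,T\}$.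
   Context: Frank-Wolfe algorithm (FW): given $x_0\in\mathcal{C}$ and step-sizes $\eta_t\in[0,1]$ for $t\in\{0,\ldots,T-1\}$, for $t=0,\ldots,T-1$ choose $p_t\in\operatorname{argmin}_{p\in\mathcal{C}}\langle\nabla f(x_t),p-x_t\rangle$ and set $x_{t+1}=(1-\eta_t)x_t+\eta_tp_t$. $(\alpha,q)$-uniformly convex set: for all $x,y\in\mathcal{C}$, $\gamma\in[0,1]$, and $z\in\mathbb{R}^d$ with $\|z\|_2=1$, it holds that $\gamma x+(1-\gamma)y+\gamma(1-\gamma)\alpha\|x-y\|_2^q\,z\in\mathcal{C}$. $L$-smooth ($L>0$): $f$ is differentiable in an open set containing $\mathcal{C}$ and $f(y)\le f(x)+\langle\nabla f(x),y-x\rangle+\frac{L}{2}\|x-y\|_2^2$ for all $x,y\in\mathcal{C}$. $(\mu,\theta)$-Hölderian error bound (with unique minimizer $x^*$ of $f$ over $\mathcal{C}$): $\mu(f(x)-f(x^* ))^\theta\ge\|x-x^*\|_2$ for all $x\in\mathcal{C}$. The diameter is with respect to $\|\cdot\|_2$. *)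

theory Defs
  imports "HOL-Analysis.Analysis"
begin

text \<open>The gradient of \<open>f\<close> at \<open>x\<close>; meaningful wherever \<open>f\<close> is differentiable, cf. the lemma below.\<close>

definition gradient :: "('a::euclidean_space \<Rightarrow> real) \<Rightarrow> 'a \<Rightarrow> 'a" where
  "gradient f x = (THE D. GDERIV f x :> D)"

lemma gradient_unique:
  fixes f :: "'a::euclidean_space \<Rightarrow> real"
  assumes "GDERIV f x :> D"
  shows "gradient f x = D"
  unfolding gradient_def
proof (rule the_equality)
  fix E assume "GDERIV f x :> E"
  then have "(\<lambda>h. h \<bullet> E) = (\<lambda>h. h \<bullet> D)"
    using assms unfolding gderiv_def by (rule has_derivative_unique)
  then show "E = D"
    by (simp add: fun_eq_iff vector_eq_ldot)
qed (fact assms)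

lemma GDERIV_gradient:
  fixes f :: "'a::euclidean_space \<Rightarrow> real"
  assumes "f differentiable (at x)"
  shows "GDERIV f x :> gradient f x"
proof -
  obtain F where F: "(f has_derivative F) (at x)"
    using assms unfolding differentiable_def by blast
  then interpret bounded_linear F by (rule has_derivative_bounded_linear)
  have "F h = h \<bullet> adjoint F 1" for h
    using adjoint_works[OF linear_axioms, of h 1] by simp
  then have "F = (\<lambda>h. h \<bullet> adjoint F 1)" by blast
  with F have "GDERIV f x :> adjoint F 1" unfolding gderiv_def by simp
  with gradient_unique[OF this] show ?thesis by simp
qed

definition uniformly_convex_set :: "real \<Rightarrow> real \<Rightarrow> 'a::euclidean_space set \<Rightarrow> bool" where
  "uniformly_convex_set \<alpha> q C \<longleftrightarrow>
     (\<forall>x\<in>C. \<forall>y\<in>C. \<forall>\<gamma>\<in>{0..1}. \<forall>z. norm z = 1 \<longrightarrow>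
        \<gamma> *\<^sub>R x + (1 - \<gamma>) *\<^sub>R y + (\<gamma> * (1 - \<gamma>) * \<alpha> * norm (x - y) powr q) *\<^sub>R z \<in> C)"

text \<open>The values of \<open>f\<close> off \<open>C\<close> matter only for the gradients at points of \<open>C\<close>.\<close>

definition L_smooth_on :: "real \<Rightarrow> 'a::euclidean_space set \<Rightarrow> ('a \<Rightarrow> real) \<Rightarrow> bool" where
  "L_smooth_on L C f \<longleftrightarrow>
     (\<exists>U. open U \<and> C \<subseteq> U \<and> (\<forall>x\<in>U. f differentiable (at x))) \<and>
     (\<forall>x\<in>C. \<forall>y\<in>C. f y \<le> f x + gradient f x \<bullet> (y - x) + L / 2 * (norm (x - y))\<^sup>2)"

text \<open>For \<open>\<theta> = 0\<close> note that \<open>0 powr 0 = 0\<close>. This agrees with the convention \<open>0\<^sup>0 = 1\<close> here: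
  if \<open>xs\<close> is the unique minimizer of \<open>f\<close> over \<open>C\<close>, the base vanishes only at \<open>x = xs\<close>, where the
  inequality holds under either convention when \<open>\<mu> > 0\<close>.\<close>

definition hoelderian_error_bound ::
    "real \<Rightarrow> real \<Rightarrow> 'a::euclidean_space set \<Rightarrow> ('a \<Rightarrow> real) \<Rightarrow> 'a \<Rightarrow> bool" where
  "hoelderian_error_bound \<mu> \<theta> C f xs \<longleftrightarrow>
     (\<forall>x\<in>C. \<mu> * (f x - f xs) powr \<theta> \<ge> norm (x - xs))"

definition unique_minimizer_on :: "'a set \<Rightarrow> ('a \<Rightarrow> real) \<Rightarrow> 'a \<Rightarrow> bool" where
  "unique_minimizer_on C f xs \<longleftrightarrow>
     is_arg_min f (\<lambda>x. x \<in> C) xs \<and> (\<forall>y. is_arg_min f (\<lambda>x. x \<in> C) y \<longrightarrow> y = xs)"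

text \<open>\<open>x\<close> are the iterates and \<open>p\<close> the vertices of a run of \<open>T\<close> iterations; the choice of each
  \<open>p t\<close> among the minimizers of the linear subproblem is arbitrary.\<close>

definition frank_wolfe ::
    "'a::euclidean_space set \<Rightarrow> ('a \<Rightarrow> real) \<Rightarrow> (nat \<Rightarrow> real) \<Rightarrow> nat \<Rightarrow> (nat \<Rightarrow> 'a) \<Rightarrow> (nat \<Rightarrow> 'a) \<Rightarrow> bool" where
  "frank_wolfe C f \<eta> T x p \<longleftrightarrow>
     x 0 \<in> C \<and>
     (\<forall>t<T. \<eta> t \<in> {0..1} \<and>
        is_arg_min (\<lambda>v. gradient f (x t) \<bullet> (v - x t)) (\<lambda>v. v \<in> C) (p t) \<and>
        x (Suc t) = (1 - \<eta> t) *\<^sub>R x t + \<eta> t *\<^sub>R p t)"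

end

theory Submission
  imports Defs
begin

text \<open>
  Write \<open>g\<^sub>t = \<langle>\<nabla>f(x\<^sub>t), x\<^sub>t - p\<^sub>t\<rangle>\<close>, \<open>r\<^sub>t = \<parallel>x\<^sub>t - p\<^sub>t\<parallel>\<close>, \<open>e = 1 - 2\<theta>/q\<close> and \<open>M = (2\<mu>/\<alpha>)\<^bsup>2/q\<^esup>\<close>.
  Smoothness gives \<open>h\<^bsub>t+1\<^esub> \<le> h\<^sub>t - \<eta>\<^sub>t g\<^sub>t + \<eta>\<^sub>t\<^sup>2 L r\<^sub>t\<^sup>2 / 2\<close>, and convexity gives \<open>h\<^sub>t \<le> g\<^sub>t\<close>.
  Uniform convexity of the set bounds \<open>r\<^sub>t\<^bsup>q\<^esup> \<parallel>\<nabla>f(x\<^sub>t)\<parallel>\<close> by a multiple of \<open>g\<^sub>t\<close>, and the error bound turns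
  \<open>\<parallel>\<nabla>f(x\<^sub>t)\<parallel>\<close> into a power of \<open>h\<^sub>t\<close>; together \<open>r\<^sub>t\<^sup>2 \<le> M g\<^sub>t / h\<^sub>t\<^bsup>e\<^esup>\<close>.
  If \<open>\<eta>\<^sub>t L M \<le> h\<^sub>t\<^bsup>e\<^esup>\<close>, then the quadratic term is at most half of the linear one and
  \<open>h\<^bsub>t+1\<^esub> \<le> (1 - \<eta>\<^sub>t/2) h\<^sub>t\<close>, where \<open>1 - \<eta>\<^sub>t/2 = \<beta>\<^bsub>t+1\<^esub>\<^sup>2 / \<beta>\<^sub>t\<^sup>2\<close> for the geometric mean
  \<open>\<beta>\<^sub>t\<close> of \<open>\<eta>\<^bsub>t-2\<^esub>\<close> and \<open>\<eta>\<^bsub>t-1\<^esub>\<close>; since \<open>1/e \<le> 2\<close>, the claimed bound with \<open>\<beta>\<^sub>t\<close> in place of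
  \<open>\<eta>\<^bsub>t-2\<^esub>\<close> shrinks no faster, so it propagates (with \<open>\<eta>\<^bsub>t-2\<^esub>\<close> itself it would not when \<open>1/e = 2\<close>). Otherwise
  \<open>h\<^sub>t\<close> is already as small as claimed, up to the term \<open>\<eta>\<^sub>t\<^sup>2 L \<delta>\<^sup>2 / 2\<close> added by the step.
\<close>

text \<open>Convexity bounds the difference quotients on the segment from \<open>x\<close> to
  \<open>y\<close> by \<open>f y - f x\<close>. The segment leaves \<open>x\<close> in one direction
  only, hence the limit from the right.\<close>

lemma convex_on_gradient_le:
  fixes f :: "'a::euclidean_space \<Rightarrow> real"
  assumes cf: "convex_on C f" and x: "x \<in> C" and y: "y \<in> C" and diff: "f differentiable (at x)"
  shows "gradient f x \<bullet> (y - x) \<le> f y - f x"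
proof -
  define \<phi> where "\<phi> s = f (x + s *\<^sub>R (y - x))" for s :: real
  have "((\<lambda>s. x + s *\<^sub>R (y - x)) has_derivative (\<lambda>s. s *\<^sub>R (y - x))) (at 0)"
    by (auto intro!: derivative_eq_intros)
  moreover have "(f has_derivative (\<lambda>v. v \<bullet> gradient f x)) (at (x + 0 *\<^sub>R (y - x)))"
    using GDERIV_gradient[OF diff] by (simp add: gderiv_def)
  ultimately have "((\<lambda>s. f (x + s *\<^sub>R (y - x))) has_derivative
      (\<lambda>s. (s *\<^sub>R (y - x)) \<bullet> gradient f x)) (at 0)"
    by (rule has_derivative_compose)
  then have "(\<phi> has_real_derivative gradient f x \<bullet> (y - x)) (at 0)"
    unfolding \<phi>_def has_field_derivative_def
    by (rule has_derivative_eq_rhs) (simp add: fun_eq_iff inner_commute)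
  then have "((\<lambda>s. (\<phi> s - \<phi> 0) / s) \<longlongrightarrow> gradient f x \<bullet> (y - x)) (at 0)"
    by (simp add: has_field_derivative_iff)
  then have lim: "((\<lambda>s. (\<phi> s - \<phi> 0) / s) \<longlongrightarrow> gradient f x \<bullet> (y - x)) (at_right 0)"
    by (rule tendsto_within_subset) simp
  have "(\<phi> s - \<phi> 0) / s \<le> f y - f x" if "0 < s" "s < 1" for s
  proof -
    have "f ((1 - s) *\<^sub>R x + s *\<^sub>R y) \<le> (1 - s) * f x + s * f y"
      using convex_onD[OF cf, of s x y] that x y by simp
    also have "(1 - s) *\<^sub>R x + s *\<^sub>R y = x + s *\<^sub>R (y - x)"
      by (simp add: algebra_simps)
    finally show ?thesis
      using that by (simp add: \<phi>_def field_simps)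
  qed
  then have "\<forall>\<^sub>F s in at_right 0. (\<phi> s - \<phi> 0) / s \<le> f y - f x"
    by (auto simp: eventually_at_right_field intro: exI[of _ 1])
  with lim show ?thesis
    by (rule tendsto_upperbound) simp
qed

text \<open>The minimality of \<open>p\<close> is tested at the midpoint of \<open>x\<close> and
  \<open>p\<close>, shifted within \<open>C\<close> by
  \<open>\<alpha> / 4 * norm (x - p) powr q\<close> in the direction opposite to
  \<open>d\<close>.\<close>

lemma uniformly_convex_set_linear_gap:
  assumes C: "uniformly_convex_set \<alpha> q C" and x: "x \<in> C" and p: "p \<in> C"
    and min: "\<And>v. v \<in> C \<Longrightarrow> d \<bullet> p \<le> d \<bullet> v"
  shows "\<alpha> * norm (x - p) powr q * norm d \<le> 2 * (d \<bullet> (x - p))"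
proof (cases "d = 0")
  case False
  define z where "z = - d /\<^sub>R norm d"
  have z: "norm z = 1" "d \<bullet> z = - norm d"
    using False by (simp_all add: z_def dot_square_norm power2_eq_square)
  have "(1/2) *\<^sub>R x + (1 - 1/2) *\<^sub>R p + ((1/2) * (1 - 1/2) * \<alpha> * norm (x - p) powr q) *\<^sub>R z \<in> C"
    using C[unfolded uniformly_convex_set_def, rule_format, of x p "1/2" z] x p z(1) by simp
  from min[OF this] show ?thesis
    using z(2) by (simp add: inner_add_right inner_diff_right algebra_simps)
qed simp

text \<open>Raising \<open>le\<close> to the power \<open>2 / q\<close> turns
  \<open>r powr q\<close> into \<open>r\<^sup>2\<close>. As \<open>1 - 2 / q\<close> is nonnegative,
  multiplying by \<open>h powr (1 - 2 / q) \<le> g powr (1 - 2 / q)\<close> then restores the first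
  power of \<open>g\<close>.\<close>

lemma vertex_distance_bound:
  fixes r g h \<alpha> q \<mu> \<theta> :: real
  assumes "0 \<le> r" "0 < h" "h \<le> g" "0 < \<alpha>" "0 < \<mu>" "2 \<le> q"
    and le: "\<alpha> * r powr q * h powr (1 - \<theta>) \<le> 2 * \<mu> * g"
  shows "r\<^sup>2 * h powr (1 - 2 * \<theta> / q) \<le> (2 * \<mu> / \<alpha>) powr (2 / q) * g"
proof -
  have "r powr q * h powr (1 - \<theta>) \<le> 2 * \<mu> / \<alpha> * g"
    using le \<open>0 < \<alpha>\<close> by (simp add: field_simps)
  then have "(r powr q * h powr (1 - \<theta>)) powr (2 / q) \<le> (2 * \<mu> / \<alpha> * g) powr (2 / q)"
    using assms by (intro powr_mono2) auto
  moreover have "(r powr q) powr (2 / q) = r\<^sup>2"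
    using assms by (simp add: powr_powr)
  ultimately have "r\<^sup>2 * h powr ((1 - \<theta>) * (2 / q)) \<le> (2 * \<mu> / \<alpha>) powr (2 / q) * g powr (2 / q)"
    by (simp only: powr_mult powr_powr)
  then have "r\<^sup>2 * h powr ((1 - \<theta>) * (2 / q)) * h powr (1 - 2 / q)
      \<le> (2 * \<mu> / \<alpha>) powr (2 / q) * g powr (2 / q) * g powr (1 - 2 / q)"
    by (rule mult_mono) (use assms in \<open>auto intro: powr_mono2\<close>)
  moreover have "h powr ((1 - \<theta>) * (2 / q)) * h powr (1 - 2 / q) = h powr (1 - 2 * \<theta> / q)"
    by (simp add: powr_add[symmetric] algebra_simps diff_divide_distrib)
  moreover have "g powr (2 / q) * g powr (1 - 2 / q) = g"
    using assms by (simp add: powr_add[symmetric])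
  ultimately show ?thesis
    by (simp add: mult.assoc)
qed

text \<open>For \<open>u \<le> 1\<close> and \<open>s \<le> 2\<close>, \<open>u powr s\<close> is at
  least \<open>u\<^sup>2\<close>. With \<open>s = 1 / e\<close> this handles the \<open>powr\<close>
  terms of the claimed bound.\<close>

lemma powr_scale_ge:
  fixes u a s c :: real
  assumes "0 < u" "u \<le> 1" "0 \<le> a" "s \<le> 2" "c \<le> u\<^sup>2"
  shows "c * a powr s \<le> (u * a) powr s"
proof -
  have "c \<le> u powr 2"
    using assms by simp
  also have "\<dots> \<le> u powr s"
    using assms by (intro powr_mono') auto
  finally show ?thesis
    using assms by (simp add: powr_mult mult_right_mono)
qed

text \<open>The hypothesis \<open>dist\<close> is the bound \<open>r\<^sub>t\<^sup>2 \<le> M g\<^sub>t / h\<^sub>t\<^bsup>e\<^esup>\<close> cleared of denominators.\<close>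

lemma half_contraction_or_small:
  fixes h h' g r \<eta> L M \<delta> e :: real
  assumes h: "0 \<le> h" "h \<le> g" and r: "0 \<le> r" "r \<le> \<delta>" and \<eta>: "0 < \<eta>"
    and L: "0 < L" and e: "0 < e"
    and step: "h' \<le> h - \<eta> * g + \<eta>\<^sup>2 * (L * r\<^sup>2 / 2)"
    and dist: "0 < h \<Longrightarrow> r\<^sup>2 * h powr e \<le> M * g"
  shows "h' \<le> (1 - \<eta> / 2) * h \<or> h' \<le> (\<eta> * L * M) powr (1 / e) + \<eta>\<^sup>2 * (L * \<delta>\<^sup>2 / 2)"
proof (cases "0 < h \<and> \<eta> * L * M \<le> h powr e")
  \<comment> \<open>The split includes \<open>0 < h\<close> because \<open>dist\<close> says nothing
    at \<open>h = 0\<close>, where the second alternative holds.\<close>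
  case True
  then have pos: "0 < h powr e" by simp
  have "(\<eta> * L * r\<^sup>2) * h powr e \<le> (\<eta> * L) * (M * g)"
    using dist True \<eta> L by (simp add: mult.assoc)
  also have "\<dots> = \<eta> * L * M * g" by simp
  also have "\<dots> \<le> h powr e * g"
    using True h by (intro mult_right_mono) auto
  finally have "\<eta> * L * r\<^sup>2 \<le> g"
    using pos by (simp add: mult.commute)
  then have "\<eta> * (\<eta> * L * r\<^sup>2) \<le> \<eta> * g"
    using \<eta> by (intro mult_left_mono) auto
  then have "h' \<le> h - \<eta> * g / 2"
    using step by (simp add: power2_eq_square algebra_simps)
  also have "\<dots> \<le> (1 - \<eta> / 2) * h"
    using h \<eta> by (simp add: algebra_simps)
  finally show ?thesis ..
next
  case notbig: False
  have "h \<le> (\<eta> * L * M) powr (1 / e)"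
  proof (cases "h = 0")
    case False
    with notbig h have "0 < h" "h powr e \<le> \<eta> * L * M" by auto
    then have "(h powr e) powr (1 / e) \<le> (\<eta> * L * M) powr (1 / e)"
      using e by (intro powr_mono2) auto
    then show ?thesis
      using \<open>0 < h\<close> e by (simp add: powr_powr)
  qed simp
  moreover have "0 \<le> \<eta> * g"
    using h \<eta> by simp
  moreover have "\<eta>\<^sup>2 * (L * r\<^sup>2 / 2) \<le> \<eta>\<^sup>2 * (L * \<delta>\<^sup>2 / 2)"
    using r L by (intro mult_left_mono divide_right_mono power_mono) auto
  ultimately show ?thesis
    using step by linarith
qed

theorem theorem3p12:
  fixes C :: "'a::euclidean_space set"
    and f :: "'a \<Rightarrow> real"
    and \<alpha> q \<delta> L \<mu> \<theta> :: real
    and xs :: 'a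
    and T :: nat
    and \<eta> :: "int \<Rightarrow> real"
    and x p :: "nat \<Rightarrow> 'a"
    and h :: "nat \<Rightarrow> real"
  assumes "\<alpha> > 0" and "q \<ge> 2"
    and "compact C" and "uniformly_convex_set \<alpha> q C"
    and "\<delta> = diameter C" and "\<delta> > 0"
    and "convex_on C f"
    and "L > 0" and "L_smooth_on L C f"
    and "\<mu> > 0" and "\<theta> \<in> {0..1/2}"
    and "unique_minimizer_on C f xs"
    and "hoelderian_error_bound \<mu> \<theta> C f xs"
    and "\<And>t. \<eta> t = 4 / (of_int t + 4)"
    and "frank_wolfe C f (\<lambda>t. \<eta> (int t)) T x p"
    and "\<And>t. h t = f (x t) - f xs"
  shows "\<forall>t\<in>{1..T}. h t \<le>
    max (\<eta> (int t - 2) powr (1 / (1 - 2 * \<theta> / q)) * (L * \<delta>\<^sup>2 / 2))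
        ((\<eta> (int t - 2) * L * (2 * \<mu> / \<alpha>) powr (2 / q)) powr (1 / (1 - 2 * \<theta> / q))
           + (\<eta> (int t - 2))\<^sup>2 * (L * \<delta>\<^sup>2 / 2))"
proof -
  define e where "e = 1 - 2 * \<theta> / q"
  define M where "M = (2 * \<mu> / \<alpha>) powr (2 / q)"
  define D where "D = L * \<delta>\<^sup>2 / 2"
  define g where "g t = gradient f (x t) \<bullet> (x t - p t)" for t
  define r where "r t = norm (x t - p t)" for t
  define \<beta> where "\<beta> t = sqrt (\<eta> (int t - 2) * \<eta> (int t - 1))" for t
  \<comment> \<open>The claimed bound as a function of the step-size value, to be evaluated at
    \<open>\<beta> t\<close> too.\<close>
  define B where "B a = max (a powr (1 / e) * D) ((a * L * M) powr (1 / e) + a\<^sup>2 * D)" for a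
  note \<eta>_eq = \<open>\<And>t. \<eta> t = 4 / (of_int t + 4)\<close> and h_eq = \<open>\<And>t. h t = f (x t) - f xs\<close>
  have "2 * \<theta> / q \<le> 1 / 2"
    using assms(2,11) by (simp add: field_simps)
  then have e: "1 / 2 \<le> e"
    by (simp add: e_def)
  then have e2: "1 / e \<le> 2"
    by (simp add: field_simps)
  have D: "0 \<le> D" and M: "0 \<le> M"
    using \<open>L > 0\<close> by (simp_all add: D_def M_def)
  have "convex C"
    using \<open>convex_on C f\<close> by (simp add: convex_on_def)
  have xs: "xs \<in> C" "\<And>v. v \<in> C \<Longrightarrow> f xs \<le> f v"
    using \<open>unique_minimizer_on C f xs\<close>
    by (auto simp: unique_minimizer_on_def is_arg_min_linorder)
  have \<eta>: "0 < \<eta> (int t)" "\<eta> (int t) \<le> 1" for t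
    by (simp_all add: \<eta>_eq)
  have fw: "p t \<in> C" "\<And>v. v \<in> C \<Longrightarrow> gradient f (x t) \<bullet> p t \<le> gradient f (x t) \<bullet> v"
      "x (Suc t) = (1 - \<eta> (int t)) *\<^sub>R x t + \<eta> (int t) *\<^sub>R p t" if "t < T" for t
    using \<open>frank_wolfe C f (\<lambda>t. \<eta> (int t)) T x p\<close> that
    by (auto simp: frank_wolfe_def is_arg_min_linorder inner_diff_right)
  have xC: "x t \<in> C" if "t \<le> T" for t
    using that
  proof (induction t)
    case 0
    then show ?case
      using \<open>frank_wolfe C f (\<lambda>t. \<eta> (int t)) T x p\<close> by (simp add: frank_wolfe_def)
  next
    case (Suc t)
    then show ?case
      using fw(1,3)[of t] \<eta>[of t] convexD_alt[OF \<open>convex C\<close>, of "x t" "p t" "\<eta> (int t)"] by simp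
  qed
  have h0: "0 \<le> h t" if "t \<le> T" for t
    using xs xC[OF that] by (simp add: h_eq)
  have r\<delta>: "r t \<le> \<delta>" if "t < T" for t
    using diameter_bounded_bound[OF compact_imp_bounded[OF \<open>compact C\<close>] xC[of t] fw(1)[of t]] that
    by (simp add: r_def \<open>\<delta> = diameter C\<close> dist_norm)
  have tangent: "h t \<le> gradient f (x t) \<bullet> (x t - xs)" if "t \<le> T" for t
  proof -
    have "f differentiable (at (x t))"
      using \<open>L_smooth_on L C f\<close> xC[OF that] by (auto simp: L_smooth_on_def)
    from convex_on_gradient_le[OF \<open>convex_on C f\<close> xC[OF that] xs(1) this] show ?thesis
      by (simp add: h_eq inner_diff_right)
  qed
  have gap: "h t \<le> g t" if "t < T" for t
    using tangent[of t] fw(2)[OF that xs(1)] that by (simp add: g_def inner_diff_right)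
  have step: "h (Suc t) \<le> h t - \<eta> (int t) * g t + (\<eta> (int t))\<^sup>2 * (L * (r t)\<^sup>2 / 2)" if "t < T" for t
  proof -
    have eq: "x (Suc t) - x t = \<eta> (int t) *\<^sub>R (p t - x t)"
      using fw(3)[OF that] by (simp add: algebra_simps)
    have "norm (x t - x (Suc t)) = \<eta> (int t) * r t"
      using \<eta>[of t] norm_minus_commute[of "x t"] eq by (simp add: r_def)
    moreover have "gradient f (x t) \<bullet> (x (Suc t) - x t) = - (\<eta> (int t) * g t)"
      by (simp add: eq g_def inner_diff_right algebra_simps)
    moreover have "f (x (Suc t)) \<le> f (x t) + gradient f (x t) \<bullet> (x (Suc t) - x t)
        + L / 2 * (norm (x t - x (Suc t)))\<^sup>2"
      using \<open>L_smooth_on L C f\<close> xC[of t] xC[of "Suc t"] that by (simp add: L_smooth_on_def)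
    ultimately show ?thesis
      by (simp add: h_eq power_mult_distrib algebra_simps)
  qed
  have dist: "(r t)\<^sup>2 * h t powr e \<le> M * g t" if "t < T" "0 < h t" for t
  proof -
    let ?d = "gradient f (x t)"
    have ucs: "\<alpha> * r t powr q * norm ?d \<le> 2 * g t"
      unfolding r_def g_def
      using uniformly_convex_set_linear_gap[OF \<open>uniformly_convex_set \<alpha> q C\<close>] xC[of t] fw(1,2) that
      by simp
    \<comment> \<open>The factor \<open>h t powr \<theta>\<close> is split off to cancel against the
      one from the error bound.\<close>
    have "h t powr \<theta> * h t powr (1 - \<theta>) = h t"
      using that by (simp add: powr_add[symmetric])
    also have "\<dots> \<le> norm ?d * norm (x t - xs)"
      using tangent[of t] that norm_cauchy_schwarz[of ?d "x t - xs"] by simp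
    also have "\<dots> \<le> norm ?d * (\<mu> * h t powr \<theta>)"
      using \<open>hoelderian_error_bound \<mu> \<theta> C f xs\<close> xC[of t] that
      by (intro mult_left_mono) (auto simp: hoelderian_error_bound_def h_eq)
    also have "\<dots> = h t powr \<theta> * (\<mu> * norm ?d)"
      by simp
    finally have grad: "h t powr (1 - \<theta>) \<le> \<mu> * norm ?d"
      using that by (subst (asm) mult_le_cancel_left_pos) auto
    have "\<alpha> * r t powr q * h t powr (1 - \<theta>) \<le> \<alpha> * r t powr q * (\<mu> * norm ?d)"
      using \<open>\<alpha> > 0\<close> grad by (intro mult_left_mono) auto
    also have "\<dots> = \<mu> * (\<alpha> * r t powr q * norm ?d)"
      by simp
    also have "\<dots> \<le> \<mu> * (2 * g t)"
      using ucs \<open>\<mu> > 0\<close> by (intro mult_left_mono) auto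
    finally show ?thesis
      using vertex_distance_bound[of "r t" "h t" "g t" \<alpha> \<mu> q \<theta>] gap[OF that(1)] that assms(1,2,10)
      by (simp add: r_def e_def M_def)
  qed
  have B_mono: "B a \<le> B b" if "0 \<le> a" "a \<le> b" for a b
    unfolding B_def using that e D M \<open>L > 0\<close>
    by (intro max.mono add_mono mult_right_mono powr_mono2 power_mono) auto
  have scale: "(1 - \<eta> (int t) / 2) * B (\<beta> t) \<le> B (\<beta> (Suc t))" for t
  proof -
    define c where "c = 1 - \<eta> (int t) / 2"
    \<comment> \<open>The common factor \<open>\<eta> (int t - 1)\<close> cancels in
      \<open>\<beta> (Suc t) / \<beta> t\<close>, leaving the root of
      \<open>\<eta> (int t) / \<eta> (int t - 2)\<close>; thus \<open>c = u\<^sup>2\<close>.\<close>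
    define u where "u = sqrt ((real t + 2) / (real t + 4))"
    define a where "a = \<beta> t"
    have ua: "\<beta> (Suc t) = u * a"
      by (simp add: u_def a_def \<beta>_def \<eta>_eq real_sqrt_mult[symmetric] divide_simps)
    have u: "0 < u" "u \<le> 1" and a: "0 \<le> a"
      by (simp_all add: u_def a_def \<beta>_def \<eta>_eq)
    have c0: "0 \<le> c"
      using \<eta>[of t] by (simp add: c_def)
    have c: "c \<le> u\<^sup>2"
      by (simp add: c_def u_def \<eta>_eq field_simps)
    have powr: "c * b powr (1 / e) \<le> (u * b) powr (1 / e)" if "0 \<le> b" for b
      using u that e2 c by (rule powr_scale_ge)
    have "c * (a powr (1 / e) * D) \<le> (u * a) powr (1 / e) * D"
      using mult_right_mono[OF powr[OF a] D] by (simp add: mult.assoc)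
    moreover have "c * ((a * L * M) powr (1 / e)) \<le> (u * a * L * M) powr (1 / e)"
      using powr[of "a * L * M"] a M \<open>L > 0\<close> by (simp add: mult.assoc)
    moreover have "c * (a\<^sup>2 * D) \<le> (u * a)\<^sup>2 * D"
      using mult_right_mono[OF c, of "a\<^sup>2 * D"] D by (simp add: power_mult_distrib mult.assoc)
    ultimately have "max (c * (a powr (1 / e) * D)) (c * ((a * L * M) powr (1 / e) + a\<^sup>2 * D)) \<le> B (u * a)"
      unfolding B_def by (intro max.mono) (simp_all add: distrib_left)
    then show ?thesis
      unfolding ua c_def[symmetric] a_def[symmetric]
      using c0 by (simp add: B_def max_mult_distrib_left)
  qed
  have inv: "h (Suc t) \<le> B (\<beta> (Suc t))" if "t < T" for t
    using that
  proof (induction t)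
    case 0
    \<comment> \<open>As \<open>\<eta> 0 = 1\<close>, the linear term absorbs \<open>h 0\<close>, so
      no initial bound is required.\<close>
    have "h (Suc 0) \<le> L * (r 0)\<^sup>2 / 2"
      using step[OF 0] gap[OF 0] by (simp add: \<eta>_eq)
    also have "\<dots> \<le> 1 * D"
      using r\<delta>[OF 0] \<open>L > 0\<close> by (simp add: D_def r_def power_mono)
    \<comment> \<open>\<open>\<beta> 1 \<ge> 1\<close>, since \<open>\<eta> (-1) = 4 / 3\<close> and
      \<open>\<eta> 0 = 1\<close>.\<close>
    also have "\<dots> \<le> (\<beta> 1) powr (1 / e) * D"
      using e D by (intro mult_right_mono ge_one_powr_ge_zero) (auto simp: \<beta>_def \<eta>_eq)
    also have "\<dots> \<le> B (\<beta> 1)"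
      by (simp add: B_def)
    finally show ?case
      by simp
  next
    case (Suc t)
    let ?t = "Suc t"
    have "h (Suc ?t) \<le> (1 - \<eta> (int ?t) / 2) * h ?t
        \<or> h (Suc ?t) \<le> (\<eta> (int ?t) * L * M) powr (1 / e) + (\<eta> (int ?t))\<^sup>2 * D"
      unfolding D_def
      using half_contraction_or_small[OF h0[of ?t] gap _ r\<delta> \<eta>(1) \<open>L > 0\<close> _ step dist] Suc.prems e
      by (simp add: r_def)
    then show ?case
    proof
      assume "h (Suc ?t) \<le> (1 - \<eta> (int ?t) / 2) * h ?t"
      also have "\<dots> \<le> (1 - \<eta> (int ?t) / 2) * B (\<beta> ?t)"
        using Suc \<eta>[of ?t] by (intro mult_left_mono) auto
      also have "\<dots> \<le> B (\<beta> (Suc ?t))"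
        by (rule scale)
      finally show ?case .
    next
      assume "h (Suc ?t) \<le> (\<eta> (int ?t) * L * M) powr (1 / e) + (\<eta> (int ?t))\<^sup>2 * D"
      also have "\<dots> \<le> B (\<eta> (int ?t))"
        by (simp add: B_def)
      \<comment> \<open>\<open>\<beta> (Suc ?t)\<close> is the geometric mean of
        \<open>\<eta> (int ?t)\<close> and the larger \<open>\<eta> (int ?t - 1)\<close>.\<close>
      also have "\<dots> \<le> B (\<beta> (Suc ?t))"
        unfolding \<beta>_def
        by (intro B_mono real_le_rsqrt) (simp_all add: \<eta>_eq power2_eq_square frac_le)
      finally show ?case .
    qed
  qed
  have "h t \<le> B (\<eta> (int t - 2))" if "t \<in> {1..T}" for t
  proof -
    have "h t \<le> B (\<beta> t)"
      using inv that by (cases t) auto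
    \<comment> \<open>Here \<open>\<eta> (int t - 2)\<close> is the larger of the two values
      averaged in \<open>\<beta> t\<close>.\<close>
    also have "\<dots> \<le> B (\<eta> (int t - 2))"
      unfolding \<beta>_def
      by (intro B_mono real_le_lsqrt) (use that in \<open>simp_all add: \<eta>_eq power2_eq_square frac_le\<close>)
    finally show ?thesis .
  qed
  then show ?thesis
    by (simp only: B_def D_def e_def M_def) blast
qed

end
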